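(* Let $m\in\mathbf{Z}\setminus\{-1,1\}$. The unital associative $\mathbf{Z}$-algebra defined by generators $s_1,s_2$ and relations $s_1s_2s_1=s_2s_1s_2$, $s_1^3=m$, $s_2^3=m$ is not finitely generated as a $\mathbf{Z}$-module. *)

theory Defs
  imports "HOL-Library.Poly_Mapping" "HOL-Algebra.QuotRing"
begin

text \<open>The free monoid on \<open>'a\<close>, written additively because the convolution product of
  \<^typ>\<open>'k \<Rightarrow>\<^sub>0 'b\<close> is taken over an additive (not necessarily commutative) monoid of exponents.\<close>

datatype 'a word = Word (letters: "'a list")

instantiation word :: (type) monoid_add
begin

definition zero_word :: "'a word" where
  "0 = Word []"

definition plus_word :: "'a word \<Rightarrow> 'a word \<Rightarrow> 'a word" where
  "u + v = Word (letters u @ letters v)"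

instance
  by standard (simp_all add: zero_word_def plus_word_def)

end

text \<open>The monoid ring of the free monoid on \<open>'g\<close> is the free unital associative
  \<open>\<int>\<close>-algebra on \<open>'g\<close>.\<close>

type_synonym 'g free_alg = "'g word \<Rightarrow>\<^sub>0 int"

definition gen :: "'g \<Rightarrow> 'g free_alg" where
  "gen g = Poly_Mapping.single (Word [g]) 1"

definition free_ring :: "'g free_alg ring" where
  "free_ring = \<lparr>carrier = UNIV, mult = (*), one = 1, zero = 0, add = (+)\<rparr>"

lemma ring_free_ring: "ring (free_ring :: 'g free_alg ring)"
proof (rule ringI)
  show "abelian_group (free_ring :: 'g free_alg ring)"
  proof (rule abelian_groupI)
    fix x :: "'g free_alg"
    show "\<exists>y\<in>carrier free_ring. y \<oplus>\<^bsub>free_ring\<^esub> x = \<zero>\<^bsub>free_ring\<^esub>"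
      by (rule bexI[of _ "- x"]) (simp_all add: free_ring_def)
  qed (simp_all add: free_ring_def algebra_simps)
  show "monoid (free_ring :: 'g free_alg ring)"
    by unfold_locales (simp_all add: free_ring_def algebra_simps)
qed (simp_all add: free_ring_def algebra_simps)

text \<open>A relation \<open>l = r\<close> is represented by the pair \<open>(l, r)\<close>; \<^const>\<open>genideal\<close> is the
  two-sided ideal generated by a set.\<close>

definition presented_ring :: "('g free_alg \<times> 'g free_alg) set \<Rightarrow> 'g free_alg set ring" where
  "presented_ring rels = free_ring Quot (Idl\<^bsub>free_ring\<^esub> {l - r | l r. (l, r) \<in> rels})"

lemma ring_presented_ring: "ring (presented_ring rels)"
proof -
  interpret ring "free_ring :: 'g free_alg ring"
    by (rule ring_free_ring)
  have "ideal (Idl\<^bsub>free_ring\<^esub> {l - r | l r. (l, r) \<in> rels}) free_ring"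
    by (rule genideal_ideal) (simp add: free_ring_def)
  then show ?thesis
    unfolding presented_ring_def by (rule ideal.quotient_is_ring)
qed

definition fin_gen_int_module :: "('a, 'b) ring_scheme \<Rightarrow> bool" where
  "fin_gen_int_module R \<longleftrightarrow>
    (\<exists>S. finite S \<and> S \<subseteq> carrier R \<and>
      (\<forall>x\<in>carrier R. \<exists>c :: 'a \<Rightarrow> int. x = (\<Oplus>\<^bsub>R\<^esub>s\<in>S. [c s] \<cdot>\<^bsub>R\<^esub> s)))"

datatype two_gens = G1 | G2

abbreviation s1 :: "two_gens free_alg" where "s1 \<equiv> gen G1"
abbreviation s2 :: "two_gens free_alg" where "s2 \<equiv> gen G2"

definition cubic_braid_alg :: "int \<Rightarrow> two_gens free_alg set ring" where
  "cubic_braid_alg m =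
    presented_ring {(s1 * s2 * s1, s2 * s1 * s2), (s1 ^ 3, of_int m), (s2 ^ 3, of_int m)}"

end

theory Submission
  imports Defs "HOL-Algebra.Generated_Groups"
begin

text \<open>
  Consider the words that occur as blocks of consecutive letters in the periodic word
  \<open>G1 G1 G2 G2 G1 G1 G2 G2 \<dots>\<close>. There are infinitely many of them, and none equals
  \<open>G1 G2 G1\<close>, \<open>G2 G1 G2\<close>, \<open>G1 G1 G1\<close> or \<open>G2 G2 G2\<close>. Modulo \<open>m\<close> the defining relations become
  \<open>s1 s2 s1 = s2 s1 s2\<close> and \<open>s1^3 = s2^3 = 0\<close>; they mention only excluded words, so they cannot
  affect the coefficient (modulo \<open>m\<close>) of a block of the periodic word. In terms of ideals: the
  elements of the free algebra whose coefficients at all these blocks are divisible by \<open>m\<close> form a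
  two-sided ideal (\<open>ideal_coeffs_dvd_on\<close>), because a factor of a block is again a block,
  and this ideal contains the relators.

  Finitely many classes have representatives that involve only finitely many words, hence miss some
  block \<open>w\<close>. If these classes spanned the quotient over \<open>\<int>\<close>, the class of \<open>w\<close> itself would be a
  combination of them, and comparing coefficients at \<open>w\<close> modulo \<open>m\<close> gives that \<open>m\<close> divides \<open>1\<close>.
  The argument for an arbitrary presentation and an arbitrary factor-closed infinite set of words is
  \<open>fin_gen_presented_imp_unit\<close>.
\<close>

definition coeffs_dvd_on :: "'g word set \<Rightarrow> int \<Rightarrow> 'g free_alg set" where
  "coeffs_dvd_on F m = {f. \<forall>w\<in>F. m dvd Poly_Mapping.lookup f w}"

lemma lookup_times_dvd:
  fixes f g :: "'g free_alg"
  assumes "\<And>u v. w = u + v \<Longrightarrow> m dvd Poly_Mapping.lookup f u * Poly_Mapping.lookup g v"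
  shows "m dvd Poly_Mapping.lookup (f * g) w"
proof -
  have dvd_Sum_any: "m dvd Sum_any h" if "\<And>x. m dvd h x" for h :: "'g word \<Rightarrow> int"
    unfolding Sum_any.expand_set using that by (intro dvd_sum)
  have "m dvd Poly_Mapping.lookup f u * Sum_any (\<lambda>v. Poly_Mapping.lookup g v when w = u + v)" for u
  proof (cases "\<exists>v. w = u + v")
    case True
    then obtain v where v: "w = u + v" by blast
    have eq: "w = u + v' \<longleftrightarrow> v' = v" for v'
      by (cases v; cases v'; auto simp: v plus_word_def)
    show ?thesis
      unfolding eq using assms[OF v] by simp
  next
    case False
    then show ?thesis by simp
  qed
  then show ?thesis
    unfolding lookup_mult by (rule dvd_Sum_any)
qed

lemma subgroup_coeffs_dvd_on:
  "subgroup (coeffs_dvd_on F m) (add_monoid (free_ring :: 'g free_alg ring))"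
proof -
  interpret ring "free_ring :: 'g free_alg ring"
    by (rule ring_free_ring)
  have minus: "\<ominus>\<^bsub>free_ring\<^esub> f = - f" for f :: "'g free_alg"
    by (rule minus_equality) (simp_all add: free_ring_def)
  show ?thesis
  proof (rule add.subgroupI)
    show "coeffs_dvd_on F m \<noteq> {}"
      by (auto simp: coeffs_dvd_on_def intro: exI[of _ 0])
  qed (auto simp: minus coeffs_dvd_on_def, auto simp: free_ring_def lookup_add)
qed

text \<open>The coefficient of a product at \<open>w\<close> is a sum over the factorizations \<open>w = u + v\<close>. For \<open>w \<in> F\<close>
  both factors lie in \<open>F\<close>, so every term has a factor divisible by \<open>m\<close>, whichever side the element
  of the ideal stands on.\<close>

lemma ideal_coeffs_dvd_on:
  fixes F :: "'g word set"
  assumes factors: "\<And>u v. u + v \<in> F \<Longrightarrow> u \<in> F \<and> v \<in> F"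
  shows "ideal (coeffs_dvd_on F m) free_ring"
proof (rule idealI[OF ring_free_ring])
  show "subgroup (coeffs_dvd_on F m) (add_monoid free_ring)"
    by (rule subgroup_coeffs_dvd_on)
next
  fix a x :: "'g free_alg"
  assume a: "a \<in> coeffs_dvd_on F m"
  have a_dvd: "m dvd Poly_Mapping.lookup a u" if "u \<in> F" for u
    using a that by (simp add: coeffs_dvd_on_def)
  have "m dvd Poly_Mapping.lookup (x * a) w" if "w \<in> F" for w
    using that by (intro lookup_times_dvd dvd_mult a_dvd) (blast dest: factors)
  then show "x \<otimes>\<^bsub>free_ring\<^esub> a \<in> coeffs_dvd_on F m"
    by (simp add: coeffs_dvd_on_def free_ring_def)
  have "m dvd Poly_Mapping.lookup (a * x) w" if "w \<in> F" for w
    using that by (intro lookup_times_dvd dvd_mult2 a_dvd) (blast dest: factors)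
  then show "a \<otimes>\<^bsub>free_ring\<^esub> x \<in> coeffs_dvd_on F m"
    by (simp add: coeffs_dvd_on_def free_ring_def)
qed

definition square_letter :: "nat \<Rightarrow> two_gens" where
  "square_letter i = (if even (i div 2) then G1 else G2)"

text \<open>These are the factors of the powers of \<open>G1^2 G2^2\<close>. They are indexed by intervals of positions
  because cutting an interval in two gives closure under factors at once.\<close>

definition square_words :: "two_gens word set" where
  "square_words = {Word (map square_letter [i..<j]) | i j. True}"

lemma square_words_factors:
  assumes "u + v \<in> square_words"
  shows "u \<in> square_words \<and> v \<in> square_words"
proof -
  obtain i j where ij: "map square_letter [i..<j] = letters u @ letters v"
    using assms by (auto simp: square_words_def plus_word_def)
  let ?k = "length (letters u)"
  have "letters u = map square_letter (take ?k [i..<j])" "letters v = map square_letter (drop ?k [i..<j])"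
    unfolding take_map[symmetric] drop_map[symmetric] ij by simp_all
  moreover have "take ?k [i..<j] = [i..<min (i + ?k) j]"
    by (cases "i + ?k \<le> j") (simp_all add: min_def)
  ultimately show ?thesis
    unfolding square_words_def drop_upt by (metis (mono_tags, lifting) mem_Collect_eq word.collapse)
qed

lemma infinite_square_words: "infinite square_words"
proof -
  have "inj (\<lambda>n. Word (map square_letter [0..<n]))"
    by (rule injI) (metis diff_zero length_map length_upt word.inject)
  then have "infinite (range (\<lambda>n. Word (map square_letter [0..<n])))"
    by (simp add: finite_image_iff)
  then show ?thesis
    by (rule infinite_super[rotated]) (auto simp: square_words_def)
qed

text \<open>In the periodic word the letter changes at every second step, so of two consecutive steps
  exactly one changes it. This rules out the braid words as well as the cubes.\<close>

lemma three_letters_in_square_words: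
  assumes "Word [a, b, c] \<in> square_words"
  shows "(b = a) \<noteq> (c = b)"
proof -
  obtain i j where ij: "[a, b, c] = map square_letter [i..<j]"
    using assms unfolding square_words_def mem_Collect_eq word.inject by (elim exE conjE)
  from arg_cong[OF this, of length] have "j = i + 3"
    by simp
  then have "[i..<j] = [i, i + 1, i + 2]"
    by (simp add: upt_rec)
  with ij have "a = square_letter i" "b = square_letter (i + 1)" "c = square_letter (i + 2)"
    by simp_all
  then show ?thesis
    by (simp add: square_letter_def)
qed

lemma relators_coeffs_dvd_on_square_words:
  assumes "(l, r) \<in> {(s1 * s2 * s1, s2 * s1 * s2), (s1 ^ 3, of_int m), (s2 ^ 3, of_int m)}"
  shows "l - r \<in> coeffs_dvd_on square_words m"
proof -
  have cubic: "gen a * gen b * gen c = Poly_Mapping.single (Word [a, b, c]) 1" for a b c :: two_gens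
    by (simp add: gen_def mult_single plus_word_def)
  have cube: "gen a ^ 3 = Poly_Mapping.single (Word [a, a, a]) 1" for a :: two_gens
    unfolding cubic[symmetric] by (simp add: numeral_3_eq_3 mult.assoc)
  have avoid: "Word [a, b, a] \<notin> square_words" if "a \<noteq> b" for a b
    using three_letters_in_square_words[of a b a] that by auto
  have avoid': "Word [a, a, a] \<notin> square_words" for a
    using three_letters_in_square_words[of a a a] by auto
  \<comment> \<open>The empty word is a block, so the constant term \<open>m\<close> is where divisibility by \<open>m\<close> is needed.\<close>
  have const: "m dvd Poly_Mapping.lookup (of_int m :: two_gens free_alg) w" for w
    by (simp add: lookup_of_int when_def)
  have off: "Poly_Mapping.lookup (Poly_Mapping.single u (1::int)) w = 0" if "w \<in> square_words" "u \<notin> square_words" for u w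
    using that by (auto simp: lookup_single when_def)
  show ?thesis
    using assms
    by (auto simp: coeffs_dvd_on_def lookup_minus cubic cube off avoid avoid' const)
qed

text \<open>The quotient is tested at a single word \<open>w \<in> F\<close> outside the supports of chosen representatives
  of the module generators. The classes having a representative with coefficient at \<open>w\<close> divisible by
  \<open>m\<close> form a subgroup that contains all the generators, hence the class of \<open>w\<close>. The ideal of relations
  changes the coefficient at \<open>w\<close> only by multiples of \<open>m\<close>, so the coefficient \<open>1\<close> of \<open>w\<close> in itself
  is such a multiple too.\<close>

lemma fin_gen_presented_imp_unit:
  fixes rels :: "('g free_alg \<times> 'g free_alg) set"
  assumes fg: "fin_gen_int_module (presented_ring rels)"
    and factors: "\<And>u v. u + v \<in> F \<Longrightarrow> u \<in> F \<and> v \<in> F"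
    and rels: "\<And>l r. (l, r) \<in> rels \<Longrightarrow> l - r \<in> coeffs_dvd_on F m"
    and inf: "infinite F"
  shows "is_unit m"
proof -
  let ?R = "free_ring :: 'g free_alg ring"
  let ?Q = "presented_ring rels"
  define I where "I = Idl\<^bsub>?R\<^esub> {l - r | l r. (l, r) \<in> rels}"
  interpret R: ring ?R by (rule ring_free_ring)
  interpret Q: ring ?Q by (rule ring_presented_ring)
  interpret I: ideal I ?R
    unfolding I_def by (rule R.genideal_ideal) (simp add: free_ring_def)
  have Q_def: "?Q = ?R Quot I"
    by (simp add: presented_ring_def I_def)
  have carrier_Q: "carrier ?Q = (\<Union>f. {I +>\<^bsub>?R\<^esub> f})"
    unfolding Q_def FactRing_def A_RCOSETS_def' by (simp add: free_ring_def)
  interpret h: ring_hom_ring ?R ?Q "(+>\<^bsub>?R\<^esub>) I"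
    unfolding Q_def by (rule I.rcos_ring_hom_ring)
  have I_sub: "I \<subseteq> coeffs_dvd_on F m"
    unfolding I_def using rels by (intro R.genideal_minimal ideal_coeffs_dvd_on factors) auto
  obtain S where "finite S \<and> S \<subseteq> carrier ?Q \<and>
      (\<forall>x\<in>carrier ?Q. \<exists>c :: 'g free_alg set \<Rightarrow> int. x = (\<Oplus>\<^bsub>?Q\<^esub>s\<in>S. [c s] \<cdot>\<^bsub>?Q\<^esub> s))"
    using fg[unfolded fin_gen_int_module_def] ..
  then have S: "finite S" "S \<subseteq> carrier ?Q"
    and span: "\<forall>x\<in>carrier ?Q. \<exists>c :: 'g free_alg set \<Rightarrow> int. x = (\<Oplus>\<^bsub>?Q\<^esub>s\<in>S. [c s] \<cdot>\<^bsub>?Q\<^esub> s)"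
    by simp_all
  have "\<exists>f. s = I +>\<^bsub>?R\<^esub> f" if "s \<in> S" for s
    using subsetD[OF S(2) that] unfolding carrier_Q by blast
  then obtain rep where rep: "\<And>s. s \<in> S \<Longrightarrow> s = I +>\<^bsub>?R\<^esub> rep s"
    by metis
  have "finite (\<Union>s\<in>S. Poly_Mapping.keys (rep s))"
    using S(1) by simp
  with inf have "\<not> F \<subseteq> (\<Union>s\<in>S. Poly_Mapping.keys (rep s))"
    using finite_subset by blast
  then obtain w where w: "w \<in> F" "\<And>s. s \<in> S \<Longrightarrow> w \<notin> Poly_Mapping.keys (rep s)"
    by blast
  define K where "K = (+>\<^bsub>?R\<^esub>) I ` coeffs_dvd_on {w} m"
  have K: "subgroup K (add_monoid ?Q)"
    unfolding K_def
    by (rule group_hom.subgroup_img_is_subgroup[OF h.a_group_hom subgroup_coeffs_dvd_on])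
  have span_K: "(\<Oplus>\<^bsub>?Q\<^esub>s\<in>T. [c s] \<cdot>\<^bsub>?Q\<^esub> s) \<in> K" if "finite T" "T \<subseteq> S" for T and c :: "'g free_alg set \<Rightarrow> int"
    using that
  proof (induction T)
    case empty
    show ?case
      using subgroup.one_closed[OF K] by simp
  next
    case (insert s T)
    have "rep s \<in> coeffs_dvd_on {w} m"
      using insert.prems w(2)[of s] by (simp add: coeffs_dvd_on_def in_keys_iff)
    then have "I +>\<^bsub>?R\<^esub> rep s \<in> K"
      unfolding K_def by (rule imageI)
    moreover have "s = I +>\<^bsub>?R\<^esub> rep s"
      using insert.prems by (intro rep) simp
    ultimately have s: "s \<in> K"
      by (rule ssubst[rotated])
    have "[c s] \<cdot>\<^bsub>?Q\<^esub> s \<in> K"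
      using Q.add.subgroup_int_pow_closed[OF K s] by (simp add: add_pow_def)
    moreover have "(\<Oplus>\<^bsub>?Q\<^esub>t\<in>insert s T. [c t] \<cdot>\<^bsub>?Q\<^esub> t) = [c s] \<cdot>\<^bsub>?Q\<^esub> s \<oplus>\<^bsub>?Q\<^esub> (\<Oplus>\<^bsub>?Q\<^esub>t\<in>T. [c t] \<cdot>\<^bsub>?Q\<^esub> t)"
      using insert.hyps insert.prems S(2) by (intro Q.finsum_insert) auto
    ultimately show ?case
      using insert subgroup.m_closed[OF K] by simp
  qed
  let ?e = "Poly_Mapping.single w 1 :: 'g free_alg"
  have e_closed: "I +>\<^bsub>?R\<^esub> ?e \<in> carrier ?Q"
    using h.hom_closed[of ?e] by (simp add: free_ring_def)
  obtain c :: "'g free_alg set \<Rightarrow> int"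
    where "I +>\<^bsub>?R\<^esub> ?e = (\<Oplus>\<^bsub>?Q\<^esub>s\<in>S. [c s] \<cdot>\<^bsub>?Q\<^esub> s)"
    using bspec[OF span e_closed] ..
  then have "I +>\<^bsub>?R\<^esub> ?e \<in> K"
    using span_K[OF S(1) subset_refl, of c] by simp
  then obtain f where f: "m dvd Poly_Mapping.lookup f w" "I +>\<^bsub>?R\<^esub> ?e = I +>\<^bsub>?R\<^esub> f"
    by (auto simp: K_def coeffs_dvd_on_def)
  have "?e \<in> I +>\<^bsub>?R\<^esub> f"
    unfolding f(2)[symmetric] by (rule I.a_rcos_self) (simp add: free_ring_def)
  then obtain i where i: "i \<in> I" "?e = i + f"
    by (auto simp: a_r_coset_def' free_ring_def)
  have "m dvd Poly_Mapping.lookup ?e w"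
    unfolding i(2) lookup_add using i(1) I_sub w(1) f(1)
    by (auto simp: coeffs_dvd_on_def intro!: dvd_add)
  then show ?thesis
    by simp
qed

theorem corollary3p3:
  fixes m :: int
  assumes "m \<notin> {-1, 1}"
  shows "\<not> fin_gen_int_module (cubic_braid_alg m)"
proof
  assume "fin_gen_int_module (cubic_braid_alg m)"
  then have "is_unit m"
    unfolding cubic_braid_alg_def
    by (rule fin_gen_presented_imp_unit)
      (rule square_words_factors relators_coeffs_dvd_on_square_words infinite_square_words; assumption?)+
  with assms show False
    by (simp add: abs_if split: if_splits)
qed

end
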